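(* Let $G$ be a Polish group and $X$ a Polish $G$-space. Suppose that $X$ is approximated by a direct limit of Polish group actions $\gamma_n:H_n\times X_n\to X_n$ ($n\in\mathbb{N}$), with associated maps $i_n^m, i_n, i, f_n^m, f_n, f$. Fix metrics inducing the Polish topology on each of the spaces $G$, $X$, $H_n$, $X_n$. Let $y\in X_0$ and assume that for each $n$ the orbit $H_n\cdot f_0^n(y)$ is dense in $X_n$. Let $J$ be a fixed natural number. Suppose that for any $\epsilon>0$, any $j\ge J$ and any $g\in H_j$ there exists a sequence $\{\alpha_n\}_{n\ge j}$ of positive real numbers satisfying: (1) for any $n\ge j$, the set $B_{H_n}\bigl(1,\mathrm{mod}(i\circ i_n,1,\epsilon)\bigr)\cdot i_j^n(g)\cdot f_0^n(y)$ is dense in $B_{X_n}\bigl(i_j^n(g)\cdot f_0^n(y),\alpha_n\bigr)$; (2) $\inf\{\mathrm{comod}\bigl(f\circ f_n,\ i_j^n(g)\cdot f_0^n(y),\ \alpha_n\bigr) : n\ge j\}>0$. Then the orbit $G\cdot (f\circ f_0(y))$ is comeager in $X$.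
   Context: A Polish $G$-space is a Polish space with a continuous action of the Polish group $G$. $B_Z(z,r)$ is the open ball of radius $r$ about $z$ in a metric space $Z$. A set $A$ is "dense in" a set $B$ if the closure of $A$ contains $B$. Direct limit of actions: each $\gamma_n$ is an action of a Polish group $H_n$ on a Polish space $X_n$; for each $n$, $i_n^{n+1}:H_n\to H_{n+1}$ is a continuous group homomorphism and $f_n^{n+1}:X_n\to X_{n+1}$ is a continuous injective map with $f_n^{n+1}(g\cdot x)=i_n^{n+1}(g)\cdot f_n^{n+1}(x)$ for all $g\in H_n$, $x\in X_n$. For $n\le m$, $i_n^m$ and $f_n^m$ denote the compositions (identity if $n=m$). The direct limit of the $\gamma_n$ is the induced action of the group $\varinjlim(H_n,i_n^{n+1})$ on $\varinjlim(X_n,f_n^{n+1})$; the latter carries the direct limit topology. $i_n:H_n\to\varinjlim(H_n,i_n^{n+1})$ and $f_n:X_n\to\varinjlim(X_n,f_n^{n+1})$ are the canonical maps. This direct limit approximates the $G$-space $X$ if there are a group homomorphism $i:\varinjlim(H_n,i_n^{n+1})\to G$ with dense image and with each $i\circ i_n$ continuous, and a continuous map $f:\varinjlim(X_n,f_n^{n+1})\to X$ which is equivariant: $f(h\cdot x)=i(h)\cdot f(x)$. For a continuous map $\varphi:(Y,d_Y)\to(Z,d_Z)$ of metric spaces, $x\in Y$ and $\epsilon>0$: $\mathrm{mod}(\varphi,x,\epsilon)=\sup\{\delta : \varphi[B_Y(x,\delta)]\subseteq B_Z(\varphi(x),\epsilon)\}$ and $\mathrm{comod}(\varphi,x,\epsilon)=\sup\{\delta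 : \varphi[B_Y(x,\epsilon)]\supseteq B_Z(\varphi(x),\delta)\cap \varphi[Y]\}$.
   Formalization: The formal theorem also assumes that the image of f is dense in X; without this the claim is false (trivial groups, one-point X_n, two-point discrete X), and the conclusion itself implies it. *)

theory Defs
  imports "HOL-Analysis.Analysis" "HOL-Algebra.Group_Action"
begin

section \<open>Polish groups and Polish spaces with a group action\<close>

definition polish_space_in :: "'a topology \<Rightarrow> bool" where
  "polish_space_in T \<longleftrightarrow> completely_metrizable_space T \<and> separable_space T"

locale polish_group = group G for G :: "'g monoid" (structure) +
  fixes T :: "'g topology"
  assumes topspace_eq: "topspace T = carrier G"
    and polish: "polish_space_in T"
    and continuous_mult: "continuous_map (prod_topology T T) T (\<lambda>(g, h). g \<otimes> h)"
    and continuous_inv: "continuous_map T T (\<lambda>g. inv g)"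

locale polish_G_space = polish_group G TG + group_action G "topspace TX" act
  for G :: "'g monoid" (structure) and TG :: "'g topology"
    and TX :: "'x topology" and act :: "'g \<Rightarrow> 'x \<Rightarrow> 'x" +
  assumes polish_X: "polish_space_in TX"
    and continuous_act: "continuous_map (prod_topology TG TX) TX (\<lambda>(g, x). act g x)"

definition dense_in :: "'a topology \<Rightarrow> 'a set \<Rightarrow> 'a set \<Rightarrow> bool" where
  "dense_in T A B \<longleftrightarrow> B \<subseteq> T closure_of A"

definition nowhere_dense_in :: "'a topology \<Rightarrow> 'a set \<Rightarrow> bool" where
  "nowhere_dense_in T A \<longleftrightarrow> A \<subseteq> topspace T \<and> T interior_of (T closure_of A) = {}"

definition meager_in :: "'a topology \<Rightarrow> 'a set \<Rightarrow> bool" where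
  "meager_in T A \<longleftrightarrow>
     (\<exists>N :: nat \<Rightarrow> 'a set. (\<forall>k. nowhere_dense_in T (N k)) \<and> A = (\<Union>k. N k))"

definition comeager_in :: "'a topology \<Rightarrow> 'a set \<Rightarrow> bool" where
  "comeager_in T A \<longleftrightarrow> A \<subseteq> topspace T \<and> meager_in T (topspace T - A)"


section \<open>Metrics, balls and moduli\<close>

text \<open>The metric is only required to induce the topology; it need not be complete.\<close>

definition compatible_metric :: "'a topology \<Rightarrow> ('a \<Rightarrow> 'a \<Rightarrow> real) \<Rightarrow> bool" where
  "compatible_metric T d \<longleftrightarrow>
     Metric_space (topspace T) d \<and> Metric_space.mtopology (topspace T) d = T"

text \<open>The suprema below may be infinite, so they are taken in \<^typ>\<open>ennreal\<close>. Accordingly balls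
  are also needed for extended radii; the ball of radius \<open>\<infinity>\<close> is the whole space.\<close>

definition emball :: "'a set \<Rightarrow> ('a \<Rightarrow> 'a \<Rightarrow> real) \<Rightarrow> 'a \<Rightarrow> ennreal \<Rightarrow> 'a set" where
  "emball M d x r = {z. x \<in> M \<and> z \<in> M \<and> ennreal (d x z) < r}"

definition modulus ::
  "'a set \<Rightarrow> ('a \<Rightarrow> 'a \<Rightarrow> real) \<Rightarrow> 'b set \<Rightarrow> ('b \<Rightarrow> 'b \<Rightarrow> real) \<Rightarrow> ('a \<Rightarrow> 'b) \<Rightarrow> 'a \<Rightarrow> real \<Rightarrow> ennreal"
  where "modulus Y dY Z dZ \<phi> x \<epsilon> =
    Sup {ennreal \<delta> |\<delta>. 0 < \<delta> \<and>
      \<phi> ` Metric_space.mball Y dY x \<delta> \<subseteq> Metric_space.mball Z dZ (\<phi> x) \<epsilon>}"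

definition comodulus ::
  "'a set \<Rightarrow> ('a \<Rightarrow> 'a \<Rightarrow> real) \<Rightarrow> 'b set \<Rightarrow> ('b \<Rightarrow> 'b \<Rightarrow> real) \<Rightarrow> ('a \<Rightarrow> 'b) \<Rightarrow> 'a \<Rightarrow> real \<Rightarrow> ennreal"
  where "comodulus Y dY Z dZ \<phi> x \<epsilon> =
    Sup {ennreal \<delta> |\<delta>. 0 < \<delta> \<and>
      Metric_space.mball Z dZ (\<phi> x) \<delta> \<inter> \<phi> ` Y \<subseteq> \<phi> ` Metric_space.mball Y dY x \<epsilon>}"


section \<open>Direct limits of sequences\<close>

text \<open>All stages of a sequence live in one type, with the \<open>n\<close>-th stage on a carrier \<open>A n\<close>;
  \<open>t n\<close> maps \<open>A n\<close> to \<open>A (Suc n)\<close>. For \<open>n \<le> m\<close>, \<open>transition t n m\<close> is the composition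
  \<open>t (m - 1) \<circ> \<dots> \<circ> t n\<close>; for \<open>m < n\<close> it is a dummy value.\<close>

primrec transition :: "(nat \<Rightarrow> 'a \<Rightarrow> 'a) \<Rightarrow> nat \<Rightarrow> nat \<Rightarrow> 'a \<Rightarrow> 'a" where
  "transition t n 0 = id"
| "transition t n (Suc m) = (if n \<le> m then t m \<circ> transition t n m else id)"

definition limit_rel ::
  "(nat \<Rightarrow> 'a set) \<Rightarrow> (nat \<Rightarrow> 'a \<Rightarrow> 'a) \<Rightarrow> ((nat \<times> 'a) \<times> (nat \<times> 'a)) set" where
  "limit_rel A t = {((n, x), (m, y)). x \<in> A n \<and> y \<in> A m \<and>
     (\<exists>p. n \<le> p \<and> m \<le> p \<and> transition t n p x = transition t m p y)}"

definition limit_set :: "(nat \<Rightarrow> 'a set) \<Rightarrow> (nat \<Rightarrow> 'a \<Rightarrow> 'a) \<Rightarrow> (nat \<times> 'a) set set" where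
  "limit_set A t = Sigma UNIV A // limit_rel A t"

definition limit_map ::
  "(nat \<Rightarrow> 'a set) \<Rightarrow> (nat \<Rightarrow> 'a \<Rightarrow> 'a) \<Rightarrow> nat \<Rightarrow> 'a \<Rightarrow> (nat \<times> 'a) set" where
  "limit_map A t n x = limit_rel A t `` {(n, x)}"

abbreviation group_limit_map ::
  "(nat \<Rightarrow> 'h monoid) \<Rightarrow> (nat \<Rightarrow> 'h \<Rightarrow> 'h) \<Rightarrow> nat \<Rightarrow> 'h \<Rightarrow> (nat \<times> 'h) set" where
  "group_limit_map H t \<equiv> limit_map (\<lambda>n. carrier (H n)) t"

abbreviation space_limit_map ::
  "(nat \<Rightarrow> 'y topology) \<Rightarrow> (nat \<Rightarrow> 'y \<Rightarrow> 'y) \<Rightarrow> nat \<Rightarrow> 'y \<Rightarrow> (nat \<times> 'y) set" where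
  "space_limit_map T t \<equiv> limit_map (\<lambda>n. topspace (T n)) t"

text \<open>Operations on classes are computed on representatives moved to a common stage; the union
  is over classes that all coincide.\<close>

definition direct_limit_group ::
  "(nat \<Rightarrow> 'h monoid) \<Rightarrow> (nat \<Rightarrow> 'h \<Rightarrow> 'h) \<Rightarrow> (nat \<times> 'h) set monoid" where
  "direct_limit_group H t =
    \<lparr>carrier = limit_set (\<lambda>n. carrier (H n)) t,
     mult = (\<lambda>a b. \<Union>(n, g)\<in>a. \<Union>(m, h)\<in>b. let p = max n m in
       group_limit_map H t p (transition t n p g \<otimes>\<^bsub>H p\<^esub> transition t m p h)),
     one = group_limit_map H t 0 \<one>\<^bsub>H 0\<^esub>\<rparr>"

text \<open>The final topology with respect to the canonical maps.\<close>

definition direct_limit_topology ::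
  "(nat \<Rightarrow> 'y topology) \<Rightarrow> (nat \<Rightarrow> 'y \<Rightarrow> 'y) \<Rightarrow> (nat \<times> 'y) set topology" where
  "direct_limit_topology T t = topology (\<lambda>U.
     U \<subseteq> limit_set (\<lambda>n. topspace (T n)) t \<and>
     (\<forall>n. openin (T n) {x \<in> topspace (T n). space_limit_map T t n x \<in> U}))"

definition direct_limit_action ::
  "(nat \<Rightarrow> 'h \<Rightarrow> 'h) \<Rightarrow> (nat \<Rightarrow> 'y topology) \<Rightarrow> (nat \<Rightarrow> 'y \<Rightarrow> 'y) \<Rightarrow> (nat \<Rightarrow> 'h \<Rightarrow> 'y \<Rightarrow> 'y)
    \<Rightarrow> (nat \<times> 'h) set \<Rightarrow> (nat \<times> 'y) set \<Rightarrow> (nat \<times> 'y) set" where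
  "direct_limit_action ht T ft \<gamma> a b =
    (\<Union>(n, g)\<in>a. \<Union>(m, x)\<in>b. let p = max n m in
       space_limit_map T ft p (\<gamma> p (transition ht n p g) (transition ft m p x)))"

text \<open>\<open>ht n\<close> and \<open>ft n\<close> are the one-step maps from stage \<open>n\<close> to stage \<open>n + 1\<close> on the
  groups and on the spaces.\<close>

locale polish_action_sequence =
  fixes H :: "nat \<Rightarrow> 'h monoid" and TH :: "nat \<Rightarrow> 'h topology"
    and T :: "nat \<Rightarrow> 'y topology" and \<gamma> :: "nat \<Rightarrow> 'h \<Rightarrow> 'y \<Rightarrow> 'y"
    and ht :: "nat \<Rightarrow> 'h \<Rightarrow> 'h" and ft :: "nat \<Rightarrow> 'y \<Rightarrow> 'y"
  assumes actions: "\<And>n. polish_G_space (H n) (TH n) (T n) (\<gamma> n)"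
    and hom_ht: "\<And>n. ht n \<in> hom (H n) (H (Suc n))"
    and continuous_ht: "\<And>n. continuous_map (TH n) (TH (Suc n)) (ht n)"
    and continuous_ft: "\<And>n. continuous_map (T n) (T (Suc n)) (ft n)"
    and inj_ft: "\<And>n. inj_on (ft n) (topspace (T n))"
    and equivariant: "\<And>n g x. \<lbrakk>g \<in> carrier (H n); x \<in> topspace (T n)\<rbrakk>
      \<Longrightarrow> ft n (\<gamma> n g x) = \<gamma> (Suc n) (ht n g) (ft n x)"

text \<open>Only the image of \<open>i\<close> is required to be dense here, not that of \<open>f\<close>.\<close>

locale approximation =
  polish_G_space G TG TX act + polish_action_sequence H TH T \<gamma> ht ft
  for G :: "'g monoid" and TG :: "'g topology"
    and TX :: "'x topology" and act :: "'g \<Rightarrow> 'x \<Rightarrow> 'x"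
    and H :: "nat \<Rightarrow> 'h monoid" and TH :: "nat \<Rightarrow> 'h topology"
    and T :: "nat \<Rightarrow> 'y topology" and \<gamma> :: "nat \<Rightarrow> 'h \<Rightarrow> 'y \<Rightarrow> 'y"
    and ht :: "nat \<Rightarrow> 'h \<Rightarrow> 'h" and ft :: "nat \<Rightarrow> 'y \<Rightarrow> 'y" +
  fixes i :: "(nat \<times> 'h) set \<Rightarrow> 'g" and f :: "(nat \<times> 'y) set \<Rightarrow> 'x"
  assumes hom_i: "i \<in> hom (direct_limit_group H ht) G"
    and dense_i: "dense_in TG (i ` carrier (direct_limit_group H ht)) (topspace TG)"
    and continuous_i: "\<And>n. continuous_map (TH n) TG (i \<circ> group_limit_map H ht n)"
    and continuous_f: "continuous_map (direct_limit_topology T ft) TX f"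
    and equivariant_f: "\<And>h x. \<lbrakk>h \<in> carrier (direct_limit_group H ht);
        x \<in> topspace (direct_limit_topology T ft)\<rbrakk>
      \<Longrightarrow> f (direct_limit_action ht T ft \<gamma> h x) = act (i h) (f x)"


section \<open>Basic facts about direct limits\<close>

lemma transition_refl [simp]: "transition t n n = id"
  by (cases n) auto

lemma transition_trans:
  assumes "n \<le> m" "m \<le> p"
  shows "transition t m p (transition t n m x) = transition t n p x"
  using assms(2,1)
proof (induction p rule: dec_induct)
  case (step k)
  then show ?case by simp
qed simp

lemma transition_in:
  assumes "\<And>n x. x \<in> A n \<Longrightarrow> t n x \<in> A (Suc n)" "n \<le> m" "x \<in> A n"
  shows "transition t n m x \<in> A m"
  using assms(2) by (induction m rule: dec_induct) (auto simp: assms)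

lemma equiv_limit_rel: "equiv (Sigma UNIV A) (limit_rel A t)"
proof (rule equivI)
  show "limit_rel A t \<subseteq> Sigma UNIV A \<times> Sigma UNIV A"
    by (auto simp: limit_rel_def)
  show "refl_on (Sigma UNIV A) (limit_rel A t)"
    by (auto simp: limit_rel_def refl_on_def)
  show "sym (limit_rel A t)"
    by (fastforce simp: limit_rel_def sym_def)
  show "trans (limit_rel A t)"
  proof (rule transI)
    fix a b c assume "(a, b) \<in> limit_rel A t" "(b, c) \<in> limit_rel A t"
    moreover obtain n x m y k z where abc: "a = (n, x)" "b = (m, y)" "c = (k, z)"
      by (metis surj_pair)
    ultimately obtain p q where mem: "x \<in> A n" "z \<in> A k"
      and p: "n \<le> p" "m \<le> p" "transition t n p x = transition t m p y"
      and q: "m \<le> q" "k \<le> q" "transition t m q y = transition t k q z"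
      by (auto simp: limit_rel_def)
    let ?r = "max p q"
    have "transition t n ?r x = transition t m ?r y"
      using p by (metis max.cobounded1 transition_trans)
    also have "\<dots> = transition t k ?r z"
      using q by (metis max.cobounded2 transition_trans)
    finally show "(a, c) \<in> limit_rel A t"
      using mem p q abc by (auto simp: limit_rel_def intro!: exI[of _ ?r])
  qed
qed

lemma limit_map_eq_iff:
  assumes "x \<in> A n" "y \<in> A m"
  shows "limit_map A t n x = limit_map A t m y \<longleftrightarrow>
    (\<exists>p. n \<le> p \<and> m \<le> p \<and> transition t n p x = transition t m p y)"
  unfolding limit_map_def
  using eq_equiv_class_iff[OF equiv_limit_rel[of A t], of "(n, x)" "(m, y)"] assms
  by (auto simp: limit_rel_def)

lemma limit_map_in: "x \<in> A n \<Longrightarrow> limit_map A t n x \<in> limit_set A t"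
  unfolding limit_map_def limit_set_def by (rule quotientI) auto

lemma limit_set_cases:
  assumes "a \<in> limit_set A t"
  obtains n x where "x \<in> A n" "a = limit_map A t n x"
  using assms unfolding limit_set_def limit_map_def by (auto elim!: quotientE)

lemma limit_map_transition:
  assumes "\<And>n x. x \<in> A n \<Longrightarrow> t n x \<in> A (Suc n)" "n \<le> m" "x \<in> A n"
  shows "limit_map A t m (transition t n m x) = limit_map A t n x"
  using assms transition_in[of A t n m x]
  by (subst limit_map_eq_iff) (auto intro!: exI[of _ m])

lemma openin_direct_limit_topology:
  "openin (direct_limit_topology T t) U \<longleftrightarrow>
     U \<subseteq> limit_set (\<lambda>n. topspace (T n)) t \<and>
     (\<forall>n. openin (T n) {x \<in> topspace (T n). space_limit_map T t n x \<in> U})"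
proof -
  let ?P = "\<lambda>U. U \<subseteq> limit_set (\<lambda>n. topspace (T n)) t \<and>
     (\<forall>n. openin (T n) {x \<in> topspace (T n). space_limit_map T t n x \<in> U})"
  have "istopology ?P"
    unfolding istopology_def
  proof (intro conjI allI impI)
    fix U V n assume "?P U" "?P V"
    then have "openin (T n) ({x \<in> topspace (T n). space_limit_map T t n x \<in> U}
        \<inter> {x \<in> topspace (T n). space_limit_map T t n x \<in> V})"
      by blast
    then show "openin (T n) {x \<in> topspace (T n). space_limit_map T t n x \<in> U \<inter> V}"
      by (rule back_subst[of "openin (T n)"]) auto
  next
    fix K n assume "\<forall>U\<in>K. ?P U"
    then have "openin (T n) (\<Union>U\<in>K. {x \<in> topspace (T n). space_limit_map T t n x \<in> U})"
      by blast
    then show "openin (T n) {x \<in> topspace (T n). space_limit_map T t n x \<in> \<Union> K}"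
      by (rule back_subst[of "openin (T n)"]) auto
  qed blast+
  then show ?thesis
    by (simp add: direct_limit_topology_def)
qed

lemma topspace_direct_limit_topology:
  "topspace (direct_limit_topology T t) = limit_set (\<lambda>n. topspace (T n)) t"
proof -
  have "{x \<in> topspace (T n). space_limit_map T t n x \<in> limit_set (\<lambda>n. topspace (T n)) t}
      = topspace (T n)" for n
    by (auto intro: limit_map_in)
  then have "openin (direct_limit_topology T t) (limit_set (\<lambda>n. topspace (T n)) t)"
    by (simp add: openin_direct_limit_topology)
  then show ?thesis
    by (metis openin_direct_limit_topology openin_subset openin_topspace subset_antisym)
qed

context polish_action_sequence
begin

lemma ht_in: "g \<in> carrier (H n) \<Longrightarrow> ht n g \<in> carrier (H (Suc n))"
  using hom_ht by (auto simp: hom_def)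

lemma ft_in: "x \<in> topspace (T n) \<Longrightarrow> ft n x \<in> topspace (T (Suc n))"
  using continuous_ft[of n] by (auto simp: continuous_map_def)

lemma transition_equivariant:
  assumes "n \<le> m" "g \<in> carrier (H n)" "x \<in> topspace (T n)"
  shows "transition ft n m (\<gamma> n g x) = \<gamma> m (transition ht n m g) (transition ft n m x)"
  using assms(1)
proof (induction m rule: dec_induct)
  case (step k)
  then show ?case
    using equivariant[of "transition ht n k g" k "transition ft n k x"] assms
      transition_in[of "\<lambda>n. carrier (H n)" ht n k g, OF ht_in]
      transition_in[of "\<lambda>n. topspace (T n)" ft n k x, OF ft_in] by auto
qed simp

lemma transition_mult:
  assumes "n \<le> m" "g \<in> carrier (H n)" "h \<in> carrier (H n)"
  shows "transition ht n m (g \<otimes>\<^bsub>H n\<^esub> h) = transition ht n m g \<otimes>\<^bsub>H m\<^esub> transition ht n m h"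
  using assms(1)
proof (induction m rule: dec_induct)
  case (step k)
  then show ?case
    using assms transition_in[of "\<lambda>n. carrier (H n)" ht n k, OF ht_in]
      hom_mult[OF hom_ht[of k]] by auto
qed simp

lemma H_mult_closed: "\<lbrakk>g \<in> carrier (H n); h \<in> carrier (H n)\<rbrakk> \<Longrightarrow> g \<otimes>\<^bsub>H n\<^esub> h \<in> carrier (H n)"
proof -
  interpret polish_G_space "H n" "TH n" "T n" "\<gamma> n" by (rule actions)
  show "\<lbrakk>g \<in> carrier (H n); h \<in> carrier (H n)\<rbrakk> \<Longrightarrow> g \<otimes>\<^bsub>H n\<^esub> h \<in> carrier (H n)"
    by (rule m_closed)
qed

lemma act_closed: "\<lbrakk>g \<in> carrier (H n); x \<in> topspace (T n)\<rbrakk> \<Longrightarrow> \<gamma> n g x \<in> topspace (T n)"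
proof -
  interpret polish_G_space "H n" "TH n" "T n" "\<gamma> n" by (rule actions)
  show "\<lbrakk>g \<in> carrier (H n); x \<in> topspace (T n)\<rbrakk> \<Longrightarrow> \<gamma> n g x \<in> topspace (T n)"
    by (rule element_image) auto
qed

lemma direct_limit_mult:
  assumes g: "g \<in> carrier (H n)" and h: "h \<in> carrier (H n)"
  shows "group_limit_map H ht n g \<otimes>\<^bsub>direct_limit_group H ht\<^esub> group_limit_map H ht n h
    = group_limit_map H ht n (g \<otimes>\<^bsub>H n\<^esub> h)"
proof -
  note tin = transition_in[of "\<lambda>n. carrier (H n)" ht, OF ht_in]
  have eq: "group_limit_map H ht (max k m) (transition ht k (max k m) a \<otimes>\<^bsub>H (max k m)\<^esub> transition ht m (max k m) b)
      = group_limit_map H ht n (g \<otimes>\<^bsub>H n\<^esub> h)"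
    if a: "(k, a) \<in> group_limit_map H ht n g" and b: "(m, b) \<in> group_limit_map H ht n h" for k a m b
  proof -
    obtain p where p: "n \<le> p" "k \<le> p" "transition ht n p g = transition ht k p a" "a \<in> carrier (H k)"
      using a by (auto simp: limit_map_def limit_rel_def)
    obtain q where q: "n \<le> q" "m \<le> q" "transition ht n q h = transition ht m q b" "b \<in> carrier (H m)"
      using b by (auto simp: limit_map_def limit_rel_def)
    define r where "r = max p q"
    have r: "p \<le> r" "q \<le> r" "n \<le> r" "k \<le> r" "m \<le> r" "max k m \<le> r" using p q by (auto simp: r_def)
    have 1: "transition ht n r g = transition ht k r a"
      using p r by (metis transition_trans)
    have 2: "transition ht n r h = transition ht m r b"
      using q r by (metis transition_trans)
    have "transition ht (max k m) r (transition ht k (max k m) a \<otimes>\<^bsub>H (max k m)\<^esub> transition ht m (max k m) b)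
       = transition ht k r a \<otimes>\<^bsub>H r\<^esub> transition ht m r b"
      using p q r tin by (simp add: transition_mult transition_trans)
    also have "\<dots> = transition ht n r (g \<otimes>\<^bsub>H n\<^esub> h)"
      using g h r 1 2 by (simp add: transition_mult)
    finally show ?thesis
      using r p q g h tin by (subst limit_map_eq_iff) (auto intro!: H_mult_closed exI[of _ r])
  qed
  have "(n, g) \<in> group_limit_map H ht n g" "(n, h) \<in> group_limit_map H ht n h"
    using g h by (auto simp: limit_map_def limit_rel_def)
  then show ?thesis
    unfolding direct_limit_group_def using eq by (force simp: Let_def)
qed

lemma direct_limit_act:
  assumes g: "g \<in> carrier (H n)" and x: "x \<in> topspace (T n)"
  shows "direct_limit_action ht T ft \<gamma> (group_limit_map H ht n g) (space_limit_map T ft n x)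
    = space_limit_map T ft n (\<gamma> n g x)"
proof -
  note tin = transition_in[of "\<lambda>n. carrier (H n)" ht, OF ht_in]
    transition_in[of "\<lambda>n. topspace (T n)" ft, OF ft_in]
  have eq: "space_limit_map T ft (max k m) (\<gamma> (max k m) (transition ht k (max k m) a) (transition ft m (max k m) b))
      = space_limit_map T ft n (\<gamma> n g x)"
    if a: "(k, a) \<in> group_limit_map H ht n g" and b: "(m, b) \<in> space_limit_map T ft n x" for k a m b
  proof -
    obtain p where p: "n \<le> p" "k \<le> p" "transition ht n p g = transition ht k p a" "a \<in> carrier (H k)"
      using a by (auto simp: limit_map_def limit_rel_def)
    obtain q where q: "n \<le> q" "m \<le> q" "transition ft n q x = transition ft m q b" "b \<in> topspace (T m)"
      using b by (auto simp: limit_map_def limit_rel_def)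
    define r where "r = max p q"
    have r: "p \<le> r" "q \<le> r" "n \<le> r" "k \<le> r" "m \<le> r" "max k m \<le> r" using p q by (auto simp: r_def)
    have 1: "transition ht n r g = transition ht k r a"
      using p r by (metis transition_trans)
    have 2: "transition ft n r x = transition ft m r b"
      using q r by (metis transition_trans)
    have "transition ft (max k m) r (\<gamma> (max k m) (transition ht k (max k m) a) (transition ft m (max k m) b))
       = \<gamma> r (transition ht k r a) (transition ft m r b)"
      using p q r tin by (simp add: transition_equivariant transition_trans)
    also have "\<dots> = transition ft n r (\<gamma> n g x)"
      using g x r 1 2 by (simp add: transition_equivariant)
    finally show ?thesis
      using r p q g x tin by (subst limit_map_eq_iff) (auto intro!: act_closed exI[of _ r])
  qed
  have "(n, g) \<in> group_limit_map H ht n g" "(n, x) \<in> space_limit_map T ft n x"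
    using g x by (auto simp: limit_map_def limit_rel_def)
  then show ?thesis
    unfolding direct_limit_action_def using eq by (force simp: Let_def)
qed

end

end

theory Submission
  imports Defs
begin

text \<open>
  Write \<open>x\<close> for the image of \<open>y\<close> in \<open>X\<close>, so that the orbit in question is the image of the
  continuous map \<open>\<pi> g = g \<cdot> x\<close> from \<open>G\<close> to \<open>X\<close>. It is dense because the orbits in the stages are
  dense. The two conditions on \<open>\<alpha>\<close> make \<open>\<pi>\<close> nearly open at every \<open>k\<close> in the dense subgroup of \<open>G\<close>
  coming from the direct limit: the closure of \<open>\<pi> ` V\<close> is a neighbourhood of \<open>\<pi> k\<close> for every
  neighbourhood \<open>V\<close> of \<open>k\<close>.

  To see this, let \<open>k\<close> be the image of \<open>g \<in> H\<^sub>j\<close> and let \<open>z n\<close> be the translate in \<open>X\<^sub>n\<close> of the image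
  of \<open>y\<close> by the image of \<open>g\<close>, a point over \<open>k \<cdot> x\<close>. Let \<open>\<delta> > 0\<close> be below all the comoduli at the
  points \<open>z n\<close>. A point within \<open>\<delta>\<close> of \<open>k \<cdot> x\<close> that comes from some stage comes from all late stages
  \<open>n\<close>, and there, by the choice of \<open>\<delta>\<close>, it is the image of a point within \<open>\<alpha> n\<close> of \<open>z n\<close>. The latter
  is a limit of points \<open>h \<cdot> z n\<close> with \<open>h\<close> so small that the image of \<open>h\<close> in \<open>G\<close> is within \<open>\<epsilon>\<close> of
  \<open>1\<close>. So the original point is a limit of points \<open>g' \<cdot> (k \<cdot> x)\<close> with \<open>g'\<close> in the \<open>\<epsilon>\<close>-ball of \<open>G\<close>.
  Since \<open>\<delta>\<close> does not depend on the stage and the stages together have dense image, the whole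
  \<open>\<delta>\<close>-ball about \<open>k \<cdot> x\<close> lies in the closure of \<open>B\<^sub>G(1, \<epsilon>) \<cdot> (k \<cdot> x)\<close>. This is
  \<open>act_image_ball_nearly_open\<close>; translation by \<open>k\<close> turns it into near openness at \<open>k\<close>.

  What remains is pure topology (\<open>comeager_image_of_nearly_open\<close>), a non-uniform relative of the
  open mapping theorem: a continuous map with dense image from a Polish space to a Hausdorff space
  which is nearly open at the points of a dense set has comeager image.
\<close>

section \<open>Nearly open maps\<close>

lemma comeager_inI:
  assumes "countable I" "I \<noteq> {}" "\<And>a. a \<in> I \<Longrightarrow> nowhere_dense_in X (N a)"
    and "A \<subseteq> topspace X" "topspace X - A \<subseteq> (\<Union>a\<in>I. N a)"
  shows "comeager_in X A"
proof -
  define M where "M k = N (from_nat_into I k) \<inter> (topspace X - A)" for k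
  have "nowhere_dense_in X (M k)" for k
  proof -
    have *: "nowhere_dense_in X (N (from_nat_into I k))"
      using assms(3) from_nat_into[OF assms(2)] by simp
    moreover have "X interior_of (X closure_of (M k))
        \<subseteq> X interior_of (X closure_of (N (from_nat_into I k)))"
      by (intro interior_of_mono closure_of_mono) (auto simp: M_def)
    ultimately show ?thesis
      by (auto simp: nowhere_dense_in_def M_def)
  qed
  moreover have "topspace X - A = (\<Union>k. M k)"
  proof
    show "topspace X - A \<subseteq> (\<Union>k. M k)"
    proof
      fix p assume p: "p \<in> topspace X - A"
      then obtain a where "a \<in> I" "p \<in> N a"
        using assms(5) by blast
      moreover obtain k where "from_nat_into I k = a"
        using assms(1) \<open>a \<in> I\<close> by (meson from_nat_into_surj)
      ultimately show "p \<in> (\<Union>k. M k)"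
        using p by (auto simp: M_def)
    qed
  qed (auto simp: M_def)
  ultimately show ?thesis
    using assms(4) by (auto simp: comeager_in_def meager_in_def)
qed

lemma nowhere_dense_in_DiffI:
  assumes "openin X U" "openin X D"
    and dense: "\<And>W. \<lbrakk>openin X W; W \<subseteq> U; W \<noteq> {}\<rbrakk> \<Longrightarrow> W \<inter> D \<noteq> {}"
  shows "nowhere_dense_in X (U - D)"
proof -
  define W where "W = X interior_of (X closure_of (U - D))"
  have W: "openin X W" "W \<subseteq> X closure_of (U - D)"
    by (auto simp: W_def interior_of_subset)
  have "D \<inter> X closure_of (U - D) = {}"
    using assms by (simp add: openin_Int_closure_of_eq_empty)
  then have WD: "W \<inter> D = {}"
    using W by blast
  have "W = {}"
  proof (rule ccontr)
    assume "W \<noteq> {}"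
    then have "W \<inter> X closure_of (U - D) \<noteq> {}"
      using W by blast
    then have "W \<inter> U \<noteq> {}"
      using W openin_Int_closure_of_eq_empty[OF W(1), of "U - D"] by blast
    then show False
      using dense[of "W \<inter> U"] WD W assms by blast
  qed
  then show ?thesis
    using assms openin_subset by (fastforce simp: nowhere_dense_in_def W_def)
qed

lemma (in Metric_space) separable_imp_second_countable:
  assumes "separable_space mtopology"
  shows "second_countable mtopology"
proof -
  obtain Q where Q: "countable Q" "Q \<subseteq> M" "mtopology closure_of Q = M"
    using assms by (auto simp: separable_space_def)
  define B where "B = (\<lambda>(q, n). mball q (inverse (real (Suc n)))) ` (Q \<times> UNIV)"
  have "\<exists>V\<in>B. x \<in> V \<and> V \<subseteq> U" if U: "openin mtopology U" "x \<in> U" for U x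
  proof -
    obtain r where r: "r > 0" "mball x r \<subseteq> U"
      using U by (auto simp: openin_mtopology)
    have x: "x \<in> M"
      using U openin_mtopology by blast
    obtain n where n: "inverse (real (Suc n)) < r / 2"
      using r reals_Archimedean[of "r / 2"] by auto
    have "x \<in> mtopology closure_of Q"
      using x Q by simp
    then obtain q where q: "q \<in> Q" "q \<in> mball x (inverse (real (Suc n)))"
      unfolding metric_closure_of mem_Collect_eq
      by (metis inverse_positive_iff_positive of_nat_0_less_iff zero_less_Suc)
    have "mball q (inverse (real (Suc n))) \<subseteq> mball x r"
      using q n commute[of q x] by (intro mball_subset) (auto simp del: of_nat_Suc)
    moreover have "x \<in> mball q (inverse (real (Suc n)))"
      using q commute[of q x] by (auto simp del: of_nat_Suc)
    moreover have "mball q (inverse (real (Suc n))) \<in> B"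
      unfolding B_def using q(1) by (intro image_eqI[of _ _ "(q, n)"]) auto
    ultimately show ?thesis
      using r by blast
  qed
  moreover have "countable B"
    using Q by (auto simp: B_def)
  moreover have "\<forall>V\<in>B. openin mtopology V"
    by (auto simp: B_def)
  ultimately show ?thesis
    unfolding second_countable_def by blast
qed

text \<open>
  Let \<open>U V\<close> be the interior of the closure of \<open>\<pi> ` V\<close>. If \<open>W \<subseteq> U V\<close> is open and nonempty, then the
  part of \<open>V\<close> that \<open>\<pi>\<close> maps into \<open>W\<close> is open and nonempty. So it contains some \<open>k \<in> K\<close>, and
  \<open>\<pi> k \<in> U V'\<close> for every small basic neighbourhood \<open>V'\<close> of \<open>k\<close>. Hence the sets \<open>U V'\<close>, where \<open>V'\<close> runs
  over the small basic open sets with closure in \<open>V\<close>, cover a dense open subset of \<open>U V\<close>. As there are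
  only countably many basic sets, a generic point \<open>p\<close> lies in none of the nowhere dense remainders,
  so that whenever \<open>p \<in> U V\<close> there is such a \<open>V'\<close> with \<open>p \<in> U V'\<close>. Iterating yields nested sets that
  shrink, by completeness, to a point \<open>g\<close>, and continuity at \<open>g\<close> forces \<open>\<pi> g = p\<close>.
\<close>

lemma comeager_image_of_nearly_open:
  assumes compl: "completely_metrizable_space S" and sep: "separable_space S"
    and Haus: "Hausdorff_space X" and cont: "continuous_map S X \<pi>"
    and K: "S closure_of K = topspace S"
    and image: "X closure_of (\<pi> ` topspace S) = topspace X"
    and nearly_open:
      "\<And>k V. \<lbrakk>k \<in> K; k \<in> V; openin S V\<rbrakk> \<Longrightarrow> \<pi> k \<in> X interior_of (X closure_of (\<pi> ` V))"
  shows "comeager_in X (\<pi> ` topspace S)"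
proof -
  obtain M d where "Metric_space M d" "Metric_space.mcomplete M d" "S = Metric_space.mtopology M d"
    using compl by (auto simp: completely_metrizable_space_def)
  then interpret Metric_space M d by simp
  have complete: mcomplete and S: "S = mtopology"
    by fact+
  have [simp]: "topspace S = M"
    by (simp add: S)
  obtain B where B: "countable B" "\<And>V. V \<in> B \<Longrightarrow> openin S V"
    "\<And>U x. \<lbrakk>openin S U; x \<in> U\<rbrakk> \<Longrightarrow> \<exists>V\<in>B. x \<in> V \<and> V \<subseteq> U"
    using separable_imp_second_countable sep S by (fastforce simp: second_countable_def)
  define U where "U V = X interior_of (X closure_of (\<pi> ` V))" for V
  define child where
    "child n V V' \<longleftrightarrow> V' \<in> B \<and> S closure_of V' \<subseteq> V \<and> (\<exists>a. V' \<subseteq> mcball a (inverse (real (Suc n))))"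
    for n V V'
  define D where "D n V = (\<Union>V'\<in>Collect (child n V). U V')" for n V
  define I where "I = insert M B \<times> (UNIV :: nat set)"

  have nowhere: "nowhere_dense_in X (U V - D n V)" if V: "openin S V" for V n
  proof (rule nowhere_dense_in_DiffI)
    show "openin X (U V)" "openin X (D n V)"
      by (auto simp: U_def D_def)
    fix W assume W: "openin X W" "W \<subseteq> U V" "W \<noteq> {}"
    then have "W \<inter> X closure_of (\<pi> ` V) \<noteq> {}"
      by (metis U_def interior_of_subset inf.orderE inf.absorb_iff2 subset_trans)
    then have "W \<inter> \<pi> ` V \<noteq> {}"
      using openin_Int_closure_of_eq_empty[OF W(1)] by blast
    moreover define O' where "O' = V \<inter> {g \<in> topspace S. \<pi> g \<in> W}"
    ultimately have "O' \<noteq> {}"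
      using openin_subset[OF V] by auto
    moreover have "openin S O'"
      unfolding O'_def using V cont W openin_continuous_map_preimage by blast
    ultimately obtain k where k: "k \<in> K" "k \<in> O'"
      using K dense_intersects_open by blast
    then have "k \<in> M"
      using \<open>openin S O'\<close> openin_subset by fastforce
    obtain r where r: "r > 0" "mcball k r \<subseteq> O'"
      using \<open>openin S O'\<close> k(2) unfolding S openin_mtopology_mcball by blast
    define s where "s = min r (inverse (real (Suc n)))"
    have "s > 0"
      using r by (simp add: s_def)
    have "openin S (mball k s)" "k \<in> mball k s"
      using \<open>s > 0\<close> \<open>k \<in> M\<close> by (auto simp: S)
    then obtain V' where V': "V' \<in> B" "k \<in> V'" "V' \<subseteq> mball k s"
      using B(3) by blast
    have "S closure_of V' \<subseteq> mcball k s"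
      unfolding S using V'(3) mball_subset_mcball by (intro closure_of_minimal) blast+
    also have "\<dots> \<subseteq> mcball k r"
      by (rule mcball_subset_concentric) (simp add: s_def)
    finally have "S closure_of V' \<subseteq> V"
      using r by (auto simp: O'_def)
    moreover have "V' \<subseteq> mcball k (inverse (real (Suc n)))"
      using V' by (force simp: s_def)
    ultimately have "child n V V'"
      using V' by (auto simp: child_def)
    moreover have "\<pi> k \<in> U V'"
      unfolding U_def using k V' B by (intro nearly_open) auto
    ultimately show "W \<inter> D n V \<noteq> {}"
      using k by (auto simp: D_def O'_def)
  qed

  have generic: "p \<in> \<pi> ` M"
    if p: "p \<in> topspace X" and avoid: "\<And>V n. V \<in> insert M B \<Longrightarrow> p \<notin> U V - D n V" for p
  proof -
    \<comment> \<open>The whole space may serve as a starting point because \<open>\<pi>\<close> has dense image.\<close>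
    have "p \<in> U M"
      using p image by (simp add: U_def)
    have "\<exists>V. \<forall>n. (V n \<in> insert M B \<and> p \<in> U (V n)) \<and> child n (V n) (V (Suc n))"
    proof (rule dependent_nat_choice)
      show "\<exists>V. V \<in> insert M B \<and> p \<in> U V"
        using \<open>p \<in> U M\<close> by blast
      fix V n assume V: "V \<in> insert M B \<and> p \<in> U V"
      then have "p \<in> D n V"
        using avoid[of V n] by blast
      then obtain V' where "child n V V'" "p \<in> U V'"
        by (auto simp: D_def)
      then show "\<exists>V'. (V' \<in> insert M B \<and> p \<in> U V') \<and> child n V V'"
        unfolding child_def by blast
    qed
    then obtain V where V: "\<And>n. p \<in> U (V n)" "\<And>n. child n (V n) (V (Suc n))"
      by blast
    \<comment> \<open>The shift avoids the initial set \<open>V 0\<close>, which need not be small.\<close>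
    define C where "C n = S closure_of (V (Suc n))" for n
    have sub: "V (Suc n) \<subseteq> C n" for n
    proof -
      have "V (Suc n) \<in> B"
        using V(2)[of n] by (simp add: child_def)
      then have "V (Suc n) \<subseteq> topspace S"
        using B(2) openin_subset by blast
      then show ?thesis
        unfolding C_def by (rule closure_of_subset)
    qed
    have small: "\<exists>a. C n \<subseteq> mcball a (inverse (real (Suc n)))" for n
    proof -
      obtain a where "V (Suc n) \<subseteq> mcball a (inverse (real (Suc n)))"
        using V(2)[of n] unfolding child_def by blast
      then have "C n \<subseteq> mcball a (inverse (real (Suc n)))"
        unfolding C_def S by (intro closure_of_minimal) auto
      then show ?thesis ..
    qed
    have in_closure: "p \<in> X closure_of (\<pi> ` V n)" for n
      using V(1)[of n] interior_of_subset[of X "X closure_of (\<pi> ` V n)"] unfolding U_def by blast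
    have "closedin mtopology (C n)" for n
      by (simp add: C_def S)
    moreover have "C n \<noteq> {}" for n
      using in_closure[of "Suc n"] sub[of n] by auto
    moreover have "decseq C"
    proof (rule decseq_SucI)
      fix n
      have "C (Suc n) \<subseteq> V (Suc n)"
        using V(2)[of "Suc n"] by (simp add: C_def child_def)
      then show "C (Suc n) \<subseteq> C n"
        using sub[of n] by blast
    qed
    moreover have "\<exists>n a. C n \<subseteq> mcball a \<epsilon>" if "\<epsilon> > 0" for \<epsilon>
    proof -
      obtain n where n: "inverse (real (Suc n)) < \<epsilon>"
        using reals_Archimedean \<open>\<epsilon> > 0\<close> by blast
      obtain a where "C n \<subseteq> mcball a (inverse (real (Suc n)))"
        using small by blast
      also have "\<dots> \<subseteq> mcball a \<epsilon>"
        using n by (intro mcball_subset_concentric) simp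
      finally show ?thesis
        by blast
    qed
    ultimately have "\<Inter> (range C) \<noteq> {}"
      by (intro complete[unfolded mcomplete_nest, THEN spec, THEN mp] conjI allI impI)
    then obtain g where g: "\<And>n. g \<in> C n"
      by blast
    then have "g \<in> M"
      using small[of 0] mcball_subset_mspace by blast
    have "\<pi> g = p"
    proof (rule ccontr)
      assume "\<pi> g \<noteq> p"
      moreover have "\<pi> g \<in> topspace X"
        using cont \<open>g \<in> M\<close> by (auto simp: continuous_map_def)
      ultimately obtain W W' where W: "openin X W" "openin X W'" "\<pi> g \<in> W" "p \<in> W'" "disjnt W W'"
        using Haus p unfolding Hausdorff_space_def by blast
      have "openin S {h \<in> topspace S. \<pi> h \<in> W}"
        using cont W openin_continuous_map_preimage by blast
      then obtain r where r: "r > 0" "mball g r \<subseteq> {h \<in> topspace S. \<pi> h \<in> W}"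
        using \<open>g \<in> M\<close> W unfolding S openin_mtopology by auto
      obtain n where n: "inverse (real (Suc n)) < r / 2"
        using r reals_Archimedean[of "r / 2"] by auto
      obtain a where a: "C n \<subseteq> mcball a (inverse (real (Suc n)))"
        using small by blast
      have "C n \<subseteq> mball g r"
      proof
        fix h assume "h \<in> C n"
        then have h: "h \<in> M" "a \<in> M" "d a h \<le> inverse (real (Suc n))" "d a g \<le> inverse (real (Suc n))"
          using a g[of n] by auto
        then have "d g h \<le> d a g + d a h"
          using triangle[of g a h] \<open>g \<in> M\<close> by (simp add: commute)
        then show "h \<in> mball g r"
          using h n \<open>g \<in> M\<close> by simp
      qed
      then have "\<pi> ` V (Suc n) \<subseteq> W"
        using sub[of n] r by blast
      then show False
        using in_closure[of "Suc n"] W unfolding in_closure_of disjnt_def by blast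
    qed
    then show ?thesis
      using \<open>g \<in> M\<close> by blast
  qed

  show ?thesis
  proof (rule comeager_inI[where I = I and N = "\<lambda>(V, n). U V - D n V"])
    show "countable I" "I \<noteq> {}"
      using B by (auto simp: I_def)
    show "nowhere_dense_in X (case a of (V, n) \<Rightarrow> U V - D n V)" if "a \<in> I" for a
      using that B(2) nowhere openin_topspace[of S] by (auto simp: I_def)
    show "\<pi> ` topspace S \<subseteq> topspace X"
      using cont by (auto simp: continuous_map_def)
    show "topspace X - \<pi> ` topspace S \<subseteq> (\<Union>a\<in>I. case a of (V, n) \<Rightarrow> U V - D n V)"
      using generic by (fastforce simp: I_def)
  qed
qed


section \<open>Moduli\<close>

lemma modulus_ball:
  assumes "Metric_space Y dY"
    and "h \<in> emball Y dY x (modulus Y dY Z dZ \<phi> x \<epsilon>)"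
  shows "\<phi> h \<in> Metric_space.mball Z dZ (\<phi> x) \<epsilon>"
proof -
  interpret Y: Metric_space Y dY by fact
  have h: "x \<in> Y" "h \<in> Y" "ennreal (dY x h) < modulus Y dY Z dZ \<phi> x \<epsilon>"
    using assms(2) by (auto simp: emball_def)
  then obtain \<delta> where "ennreal (dY x h) < ennreal \<delta>"
    "\<phi> ` Y.mball x \<delta> \<subseteq> Metric_space.mball Z dZ (\<phi> x) \<epsilon>"
    unfolding modulus_def less_Sup_iff by blast
  then show ?thesis
    using h Y.nonneg by (auto simp: ennreal_less_iff)
qed

lemma comodulus_ball:
  assumes "Metric_space Z dZ" "ennreal \<delta> < comodulus Y dY Z dZ \<phi> x \<epsilon>"
  shows "Metric_space.mball Z dZ (\<phi> x) \<delta> \<inter> \<phi> ` Y \<subseteq> \<phi> ` Metric_space.mball Y dY x \<epsilon>"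
proof -
  interpret Z: Metric_space Z dZ by fact
  obtain \<eta> where \<eta>: "0 < \<eta>" "ennreal \<delta> < ennreal \<eta>"
    "Z.mball (\<phi> x) \<eta> \<inter> \<phi> ` Y \<subseteq> \<phi> ` Metric_space.mball Y dY x \<epsilon>"
    using assms(2) unfolding comodulus_def less_Sup_iff by blast
  then have "\<delta> \<le> \<eta>"
    by (metis ennreal_leI less_imp_le linorder_not_le)
  then show ?thesis
    using \<eta>(3) Z.mball_subset_concentric by blast
qed


section \<open>Near openness of orbit maps\<close>

lemma (in polish_group) right_translate_open:
  assumes "k \<in> carrier G" "openin T V"
  shows "openin T {h \<in> carrier G. h \<otimes> k \<in> V}"
proof -
  have "continuous_map T T ((\<lambda>(g, h). g \<otimes> h) \<circ> (\<lambda>h. (h, k)))"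
    using assms topspace_eq
    by (intro continuous_map_compose[OF _ continuous_mult]) (auto simp: continuous_map_pairedI)
  then show ?thesis
    using openin_continuous_map_preimage[OF _ assms(2)] topspace_eq by (fastforce simp: o_def)
qed

lemma continuous_map_space_limit_map:
  "continuous_map (T n) (direct_limit_topology T t) (space_limit_map T t n)"
  by (auto simp: continuous_map_def topspace_direct_limit_topology openin_direct_limit_topology
      intro: limit_map_in)

context approximation
begin

abbreviation group_stage :: "nat \<Rightarrow> 'h \<Rightarrow> 'g" where
  "group_stage n \<equiv> i \<circ> group_limit_map H ht n"

abbreviation space_stage :: "nat \<Rightarrow> 'y \<Rightarrow> 'x" where
  "space_stage n \<equiv> f \<circ> space_limit_map T ft n"

lemma group_limit_map_in:
  "g \<in> carrier (H n) \<Longrightarrow> group_limit_map H ht n g \<in> carrier (direct_limit_group H ht)"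
  by (auto simp: direct_limit_group_def intro: limit_map_in)

lemma group_stage_hom: "group_stage n \<in> hom (H n) G"
proof (rule homI)
  fix g assume "g \<in> carrier (H n)"
  then show "group_stage n g \<in> carrier G"
    using hom_in_carrier[OF hom_i] group_limit_map_in by auto
next
  fix g h assume "g \<in> carrier (H n)" "h \<in> carrier (H n)"
  then show "group_stage n (g \<otimes>\<^bsub>H n\<^esub> h) = group_stage n g \<otimes>\<^bsub>G\<^esub> group_stage n h"
    using hom_mult[OF hom_i] group_limit_map_in by (simp flip: direct_limit_mult)
qed

lemma group_H: "group (H n)"
  using actions[of n] by (simp add: polish_G_space_def polish_group_def)

lemma topspace_TH: "topspace (TH n) = carrier (H n)"
  using actions[of n] polish_G_space.axioms(1) polish_group.topspace_eq by blast

lemma group_stage_one: "group_stage n \<one>\<^bsub>H n\<^esub> = \<one>\<^bsub>G\<^esub>"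
  using group_stage_hom group_H group_axioms by (intro hom_one)

lemma continuous_space_stage: "continuous_map (T n) TX (space_stage n)"
  using continuous_map_space_limit_map continuous_f by (rule continuous_map_compose)

lemma space_stage_equivariant:
  assumes "g \<in> carrier (H n)" "x \<in> topspace (T n)"
  shows "space_stage n (\<gamma> n g x) = act (group_stage n g) (space_stage n x)"
  using assms equivariant_f[of "group_limit_map H ht n g" "space_limit_map T ft n x"]
    group_limit_map_in limit_map_in[of x "\<lambda>n. topspace (T n)" n ft]
  by (simp add: direct_limit_act topspace_direct_limit_topology)

lemma space_stage_transition:
  assumes "n \<le> m" "x \<in> topspace (T n)"
  shows "space_stage m (transition ft n m x) = space_stage n x"
  using limit_map_transition[of "\<lambda>n. topspace (T n)" ft n m x] ft_in assms by simp

lemma group_stage_transition: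
  assumes "n \<le> m" "g \<in> carrier (H n)"
  shows "group_stage m (transition ht n m g) = group_stage n g"
  using limit_map_transition[of "\<lambda>n. carrier (H n)" ht n m g] ht_in assms by simp

lemma transition_H_in:
  "\<lbrakk>n \<le> m; g \<in> carrier (H n)\<rbrakk> \<Longrightarrow> transition ht n m g \<in> carrier (H m)"
  using transition_in[of "\<lambda>n. carrier (H n)" ht] ht_in by blast

lemma transition_T_in:
  "\<lbrakk>n \<le> m; x \<in> topspace (T n)\<rbrakk> \<Longrightarrow> transition ft n m x \<in> topspace (T m)"
  using transition_in[of "\<lambda>n. topspace (T n)" ft] ft_in by blast

text \<open>The stages only grow along the transition maps, so any initial segment of them may be dropped.
  This matters because \<open>\<alpha> n\<close> is controlled only from the stage on at which the group element
  appears.\<close>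

lemma direct_limit_image_late_stages:
  "f ` topspace (direct_limit_topology T ft) \<subseteq> (\<Union>n\<in>{j..}. space_stage n ` topspace (T n))"
proof
  fix w assume "w \<in> f ` topspace (direct_limit_topology T ft)"
  then obtain n x where x: "x \<in> topspace (T n)" "w = space_stage n x"
    by (auto simp: topspace_direct_limit_topology elim!: limit_set_cases)
  then have "w = space_stage (max n j) (transition ft n (max n j) x)"
    using space_stage_transition[of n "max n j" x] by simp
  then show "w \<in> (\<Union>n\<in>{j..}. space_stage n ` topspace (T n))"
    using x transition_T_in[of n "max n j" x] by (intro UN_I[of "max n j"]) auto
qed

lemma group_limit_late_stage:
  assumes "k \<in> carrier (direct_limit_group H ht)"
  obtains n g where "j \<le> n" "g \<in> carrier (H n)" "i k = group_stage n g"
proof -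
  obtain n g where "g \<in> carrier (H n)" "i k = group_stage n g"
    using assms by (auto simp: direct_limit_group_def elim!: limit_set_cases)
  then show ?thesis
    using that[of "max n j" "transition ht n (max n j) g"] transition_H_in[of n "max n j" g]
      group_stage_transition[of n "max n j" g] by simp
qed

text \<open>The infimum of the comoduli is what makes the argument uniform: a single radius \<open>\<delta>\<close> has to
  serve for the points coming from all stages, because these are dense near \<open>p\<close> only together.\<close>

lemma act_image_ball_nearly_open:
  assumes dense_f: "dense_in TX (f ` topspace (direct_limit_topology T ft)) (topspace TX)"
    and metric_G: "compatible_metric TG dG" and metric_X: "compatible_metric TX dX"
    and metric_H: "\<And>n. compatible_metric (TH n) (dH n)"
    and metric_T: "\<And>n. compatible_metric (T n) (d n)"
    and z: "\<And>n. j \<le> n \<Longrightarrow> z n \<in> topspace (T n)" "\<And>n. j \<le> n \<Longrightarrow> space_stage n (z n) = p"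
    and dense_z: "\<And>n. j \<le> n \<Longrightarrow> dense_in (T n)
             ((\<lambda>h. \<gamma> n h (z n)) ` emball (carrier (H n)) (dH n) \<one>\<^bsub>H n\<^esub>
                (modulus (carrier (H n)) (dH n) (carrier G) dG (group_stage n) \<one>\<^bsub>H n\<^esub> \<epsilon>))
             (Metric_space.mball (topspace (T n)) (d n) (z n) (\<alpha> n))"
    and comod: "0 < (INF n\<in>{j..}. comodulus (topspace (T n)) (d n) (topspace TX) dX
             (space_stage n) (z n) (\<alpha> n))"
  shows "p \<in> TX interior_of
           (TX closure_of ((\<lambda>g. act g p) ` Metric_space.mball (carrier G) dG \<one>\<^bsub>G\<^esub> \<epsilon>))"
proof -
  interpret X: Metric_space "topspace TX" dX
    using metric_X by (simp add: compatible_metric_def)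
  have TX: "X.mtopology = TX"
    using metric_X by (simp add: compatible_metric_def)
  let ?A = "(\<lambda>g. act g p) ` Metric_space.mball (carrier G) dG \<one>\<^bsub>G\<^esub> \<epsilon>"
  obtain \<delta> where \<delta>: "0 < \<delta>" "ennreal \<delta> < (INF n\<in>{j..}. comodulus (topspace (T n)) (d n)
      (topspace TX) dX (space_stage n) (z n) (\<alpha> n))"
  proof -
    obtain e where "0 < e" "e < (INF n\<in>{j..}. comodulus (topspace (T n)) (d n)
        (topspace TX) dX (space_stage n) (z n) (\<alpha> n))"
      using dense[OF comod] by blast
    then show ?thesis
      using that by (cases e) auto
  qed
  have p: "p \<in> topspace TX"
    using z[of j] continuous_space_stage[of j] unfolding continuous_map_def by auto
  have late: "w \<in> TX closure_of ?A"
    if n: "j \<le> n" and w: "w \<in> X.mball p \<delta>" "w \<in> space_stage n ` topspace (T n)" for n w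
  proof -
    let ?E = "emball (carrier (H n)) (dH n) \<one>\<^bsub>H n\<^esub>
                (modulus (carrier (H n)) (dH n) (carrier G) dG (group_stage n) \<one>\<^bsub>H n\<^esub> \<epsilon>)"
    have \<delta>n: "ennreal \<delta> < comodulus (topspace (T n)) (d n) (topspace TX) dX (space_stage n) (z n) (\<alpha> n)"
      using \<delta>(2) n by (meson INF_lower atLeast_iff less_le_trans)
    have "w \<in> X.mball (space_stage n (z n)) \<delta> \<inter> space_stage n ` topspace (T n)"
      using w z(2)[OF n] by simp
    also have "\<dots> \<subseteq> space_stage n ` Metric_space.mball (topspace (T n)) (d n) (z n) (\<alpha> n)"
      by (rule comodulus_ball[OF X.Metric_space_axioms \<delta>n])
    also have "\<dots> \<subseteq> space_stage n ` (T n closure_of ((\<lambda>h. \<gamma> n h (z n)) ` ?E))"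
      using dense_z[OF n] unfolding dense_in_def by (rule image_mono)
    also have "\<dots> \<subseteq> TX closure_of (space_stage n ` (\<lambda>h. \<gamma> n h (z n)) ` ?E)"
      by (rule continuous_map_image_closure_subset[OF continuous_space_stage])
    also have "\<dots> \<subseteq> TX closure_of ?A"
    proof (rule closure_of_mono, safe)
      fix h assume h: "h \<in> ?E"
      then have hH: "h \<in> carrier (H n)"
        by (simp add: emball_def)
      have "Metric_space (carrier (H n)) (dH n)"
        using metric_H[of n] by (simp add: compatible_metric_def topspace_TH)
      then have "group_stage n h \<in> Metric_space.mball (carrier G) dG \<one>\<^bsub>G\<^esub> \<epsilon>"
        using modulus_ball[OF _ h] group_stage_one by simp
      moreover have "space_stage n (\<gamma> n h (z n)) = act (group_stage n h) p"
        using space_stage_equivariant[OF hH z(1)[OF n]] z(2)[OF n] by simp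
      ultimately show "space_stage n (\<gamma> n h (z n)) \<in> ?A"
        by blast
    qed
    finally show ?thesis .
  qed
  have "openin TX (X.mball p \<delta>)"
    using X.openin_mball TX by metis
  have "X.mball p \<delta> \<inter> topspace TX
      \<subseteq> TX closure_of (X.mball p \<delta> \<inter> f ` topspace (direct_limit_topology T ft))"
    using openin_Int_closure_of_subset[OF \<open>openin TX (X.mball p \<delta>)\<close>] dense_f
    unfolding dense_in_def by blast
  also have "\<dots> \<subseteq> TX closure_of (TX closure_of ?A)"
    using late direct_limit_image_late_stages[of j] by (intro closure_of_mono) blast
  finally have "X.mball p \<delta> \<subseteq> TX closure_of ?A"
    using X.mball_subset_mspace by auto
  then show ?thesis
    using interior_of_maximal[OF _ \<open>openin TX (X.mball p \<delta>)\<close>] p \<delta>(1) by auto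
qed

lemma orbit_dense:
  assumes dense_f: "dense_in TX (f ` topspace (direct_limit_topology T ft)) (topspace TX)"
    and y: "y \<in> topspace (T 0)"
    and dense_orbit: "\<And>n. dense_in (T n) (orbit (H n) (\<gamma> n) (transition ft 0 n y)) (topspace (T n))"
  shows "TX closure_of (orbit G act (space_stage 0 y)) = topspace TX"
proof -
  let ?O = "orbit G act (space_stage 0 y)"
  have "space_stage n ` topspace (T n) \<subseteq> TX closure_of ?O" for n
  proof -
    let ?y = "transition ft 0 n y"
    have y': "?y \<in> topspace (T n)"
      using y transition_T_in by blast
    have "space_stage n ` topspace (T n) \<subseteq> space_stage n ` (T n closure_of (orbit (H n) (\<gamma> n) ?y))"
      using dense_orbit[of n] unfolding dense_in_def by (rule image_mono)
    also have "\<dots> \<subseteq> TX closure_of (space_stage n ` orbit (H n) (\<gamma> n) ?y)"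
      by (rule continuous_map_image_closure_subset[OF continuous_space_stage])
    also have "\<dots> \<subseteq> TX closure_of ?O"
    proof (rule closure_of_mono, safe)
      fix w assume "w \<in> orbit (H n) (\<gamma> n) ?y"
      then obtain g where g: "g \<in> carrier (H n)" "w = \<gamma> n g ?y"
        by (auto simp: orbit_def)
      then have "space_stage n w = act (group_stage n g) (space_stage 0 y)"
        using space_stage_equivariant[OF g(1) y'] space_stage_transition[of 0 n y] y by simp
      then show "space_stage n w \<in> ?O"
        using hom_in_carrier[OF group_stage_hom g(1)] by (auto simp: orbit_def)
    qed
    finally show ?thesis .
  qed
  then have "f ` topspace (direct_limit_topology T ft) \<subseteq> TX closure_of ?O"
    using direct_limit_image_late_stages[of 0] by blast
  then have "TX closure_of (f ` topspace (direct_limit_topology T ft)) \<subseteq> TX closure_of ?O"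
    using closure_of_minimal closedin_closure_of by metis
  then have "topspace TX \<subseteq> TX closure_of ?O"
    using dense_f unfolding dense_in_def by (rule subset_trans[rotated])
  then show ?thesis
    by (rule subset_antisym[OF closure_of_subset_topspace])
qed

end


section \<open>Comeager orbits\<close>


theorem proposition2p3:
  fixes G :: "'g monoid" and TG :: "'g topology"
    and TX :: "'x topology" and act :: "'g \<Rightarrow> 'x \<Rightarrow> 'x"
    and H :: "nat \<Rightarrow> 'h monoid" and TH :: "nat \<Rightarrow> 'h topology"
    and T :: "nat \<Rightarrow> 'y topology" and \<gamma> :: "nat \<Rightarrow> 'h \<Rightarrow> 'y \<Rightarrow> 'y"
    and ht :: "nat \<Rightarrow> 'h \<Rightarrow> 'h" and ft :: "nat \<Rightarrow> 'y \<Rightarrow> 'y"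
    and i :: "(nat \<times> 'h) set \<Rightarrow> 'g" and f :: "(nat \<times> 'y) set \<Rightarrow> 'x"
    and dG :: "'g \<Rightarrow> 'g \<Rightarrow> real" and dX :: "'x \<Rightarrow> 'x \<Rightarrow> real"
    and dH :: "nat \<Rightarrow> 'h \<Rightarrow> 'h \<Rightarrow> real" and d :: "nat \<Rightarrow> 'y \<Rightarrow> 'y \<Rightarrow> real"
    and y :: 'y and J :: nat
  assumes approx: "approximation G TG TX act H TH T \<gamma> ht ft i f"
    and dense_f: "dense_in TX (f ` topspace (direct_limit_topology T ft)) (topspace TX)"
    and metric_G: "compatible_metric TG dG"
    and metric_X: "compatible_metric TX dX"
    and metric_H: "\<And>n. compatible_metric (TH n) (dH n)"
    and metric_T: "\<And>n. compatible_metric (T n) (d n)"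
    and y: "y \<in> topspace (T 0)"
    and dense_orbit: "\<And>n. dense_in (T n) (orbit (H n) (\<gamma> n) (transition ft 0 n y)) (topspace (T n))"
    and main: "\<And>\<epsilon> j g. \<lbrakk>0 < \<epsilon>; J \<le> j; g \<in> carrier (H j)\<rbrakk> \<Longrightarrow>
      \<exists>\<alpha> :: nat \<Rightarrow> real.
        (\<forall>n\<ge>j. 0 < \<alpha> n) \<and>
        (\<forall>n\<ge>j. let z = \<gamma> n (transition ht j n g) (transition ft 0 n y) in
           dense_in (T n)
             ((\<lambda>h. \<gamma> n h z) ` emball (carrier (H n)) (dH n) \<one>\<^bsub>H n\<^esub>
                (modulus (carrier (H n)) (dH n) (carrier G) dG
                   (i \<circ> group_limit_map H ht n) \<one>\<^bsub>H n\<^esub> \<epsilon>))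
             (Metric_space.mball (topspace (T n)) (d n) z (\<alpha> n))) \<and>
        0 < (INF n\<in>{j..}.
           comodulus (topspace (T n)) (d n) (topspace TX) dX (f \<circ> space_limit_map T ft n)
             (\<gamma> n (transition ht j n g) (transition ft 0 n y)) (\<alpha> n))"
  shows "comeager_in TX (orbit G act (f (space_limit_map T ft 0 y)))"
proof -
  interpret approximation G TG TX act H TH T \<gamma> ht ft i f
    by (rule approx)
  define x where "x = space_stage 0 y"
  have x: "x \<in> topspace TX"
    unfolding x_def using y continuous_space_stage[of 0] unfolding continuous_map_def by auto
  let ?\<pi> = "\<lambda>g. act g x"
  let ?K = "i ` carrier (direct_limit_group H ht)"
  have orbit: "orbit G act x = ?\<pi> ` topspace TG"
    using topspace_eq by (auto simp: orbit_def)
  interpret MG: Metric_space "carrier G" dG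
    using metric_G topspace_eq by (simp add: compatible_metric_def)
  have TG: "MG.mtopology = TG"
    using metric_G topspace_eq by (simp add: compatible_metric_def)
  have "comeager_in TX (?\<pi> ` topspace TG)"
  proof (rule comeager_image_of_nearly_open)
    show "completely_metrizable_space TG" "separable_space TG"
      using polish by (auto simp: polish_space_in_def)
    show "Hausdorff_space TX"
      using polish_X completely_metrizable_imp_metrizable_space metrizable_imp_Hausdorff_space
      by (auto simp: polish_space_in_def)
    have "continuous_map TG TX ((\<lambda>(g, x). act g x) \<circ> (\<lambda>g. (g, x)))"
      using x by (intro continuous_map_compose[OF _ continuous_act]) (auto simp: continuous_map_pairedI)
    then show "continuous_map TG TX ?\<pi>"
      by (simp add: o_def)
    show "TG closure_of ?K = topspace TG"
      using dense_i unfolding dense_in_def by (rule subset_antisym[OF closure_of_subset_topspace])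
    show "TX closure_of (?\<pi> ` topspace TG) = topspace TX"
      using orbit_dense[OF dense_f y dense_orbit] orbit by (simp add: x_def)
    fix k V assume k: "k \<in> ?K" and V: "k \<in> V" "openin TG V"
    then obtain a where "a \<in> carrier (direct_limit_group H ht)" "k = i a"
      by blast
    then obtain j g where g: "J \<le> j" "g \<in> carrier (H j)" "k = group_stage j g"
      using group_limit_late_stage[of a J] by metis
    have kG: "k \<in> carrier G"
      using hom_in_carrier[OF group_stage_hom g(2)] g(3) by simp
    \<comment> \<open>Near openness at \<open>k\<close> is reduced to small balls about the identity, acting on \<open>k \<cdot> x\<close>.\<close>
    have "openin TG {h \<in> carrier G. h \<otimes>\<^bsub>G\<^esub> k \<in> V}"
      using kG V(2) by (rule right_translate_open)
    moreover have "\<one>\<^bsub>G\<^esub> \<in> {h \<in> carrier G. h \<otimes>\<^bsub>G\<^esub> k \<in> V}"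
      using kG V(1) by simp
    ultimately obtain \<epsilon> where \<epsilon>: "0 < \<epsilon>" "MG.mball \<one>\<^bsub>G\<^esub> \<epsilon> \<subseteq> {h \<in> carrier G. h \<otimes>\<^bsub>G\<^esub> k \<in> V}"
      unfolding TG[symmetric] MG.openin_mtopology by blast
    define z where "z n = \<gamma> n (transition ht j n g) (transition ft 0 n y)" for n
    obtain \<alpha> where \<alpha>:
      "\<And>n. j \<le> n \<Longrightarrow> dense_in (T n)
             ((\<lambda>h. \<gamma> n h (z n)) ` emball (carrier (H n)) (dH n) \<one>\<^bsub>H n\<^esub>
                (modulus (carrier (H n)) (dH n) (carrier G) dG (group_stage n) \<one>\<^bsub>H n\<^esub> \<epsilon>))
             (Metric_space.mball (topspace (T n)) (d n) (z n) (\<alpha> n))"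
      "0 < (INF n\<in>{j..}. comodulus (topspace (T n)) (d n) (topspace TX) dX
             (space_stage n) (z n) (\<alpha> n))"
      using main[OF \<epsilon>(1) g(1,2)] unfolding z_def Let_def by blast
    have z: "z n \<in> topspace (T n)" "space_stage n (z n) = act k x" if "j \<le> n" for n
    proof -
      have mem: "transition ht j n g \<in> carrier (H n)" "transition ft 0 n y \<in> topspace (T n)"
        using that g y transition_H_in transition_T_in by auto
      then show "z n \<in> topspace (T n)"
        unfolding z_def by (rule act_closed)
      show "space_stage n (z n) = act k x"
        using space_stage_equivariant[OF mem] space_stage_transition[of 0 n y]
          group_stage_transition[OF that g(2)] y g(3) by (simp add: z_def x_def)
    qed
    have "act k x \<in> TX interior_of
        (TX closure_of ((\<lambda>h. act h (act k x)) ` MG.mball \<one>\<^bsub>G\<^esub> \<epsilon>))"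
      using z \<alpha> by (intro act_image_ball_nearly_open[OF dense_f metric_G metric_X metric_H metric_T])
    moreover have "(\<lambda>h. act h (act k x)) ` MG.mball \<one>\<^bsub>G\<^esub> \<epsilon> \<subseteq> ?\<pi> ` V"
    proof safe
      fix h assume "h \<in> MG.mball \<one>\<^bsub>G\<^esub> \<epsilon>"
      then have h: "h \<in> carrier G" "h \<otimes>\<^bsub>G\<^esub> k \<in> V"
        using \<epsilon>(2) by auto
      then show "act h (act k x) \<in> ?\<pi> ` V"
        using composition_rule[OF x h(1) kG] by (intro image_eqI[of _ _ "h \<otimes>\<^bsub>G\<^esub> k"]) auto
    qed
    ultimately show "act k x \<in> TX interior_of (TX closure_of (?\<pi> ` V))"
      by (meson interior_of_mono closure_of_mono subsetD)
  qed
  then show ?thesis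
    using orbit by (simp add: x_def)
qed

end
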